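(* Let $G$ be a finite simple graph with at least one vertex whose complement $G^c$ is chordal and clique vertex irreducible. Then $\operatorname{bp}(G)=\operatorname{mc}(G^c)-1$.
   Context: A graph is chordal if it has no induced cycle of length greater than $3$. A graph is clique vertex irreducible if every maximal clique of it contains a vertex that lies in no other maximal clique. $\operatorname{mc}(H)$ is the number of maximal cliques of $H$. A biclique $\{L,R\}$ is the complete bipartite graph with disjoint vertex sets $L,R$ and edge set $\{uv:u\in L,v\in R\}$; a biclique partition of $G$ is a collection of biclique subgraphs of $G$ such that every edge lies in exactly one of them; $\operatorname{bp}(G)$ is the minimum size of a biclique partition. *)

theory Defs
  imports Main
begin

text \<open>A graph is a pair of a vertex set and a set of edges, an edge being the two-element set
  of its endpoints.\<close>

type_synonym 'a ugraph = "'a set \<times> 'a set set"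

abbreviation vertices :: "'a ugraph \<Rightarrow> 'a set" where
  "vertices G \<equiv> fst G"

abbreviation edges :: "'a ugraph \<Rightarrow> 'a set set" where
  "edges G \<equiv> snd G"

definition finite_simple_graph :: "'a ugraph \<Rightarrow> bool" where
  "finite_simple_graph G \<longleftrightarrow>
     finite (vertices G) \<and> (\<forall>e \<in> edges G. e \<subseteq> vertices G \<and> card e = 2)"

definition complement :: "'a ugraph \<Rightarrow> 'a ugraph" where
  "complement G =
     (vertices G,
      {{u, v} |u v. u \<in> vertices G \<and> v \<in> vertices G \<and> u \<noteq> v \<and> {u, v} \<notin> edges G})"

definition subgraph :: "'a ugraph \<Rightarrow> 'a ugraph \<Rightarrow> bool" where
  "subgraph H G \<longleftrightarrow> vertices H \<subseteq> vertices G \<and> edges H \<subseteq> edges G"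

definition induced_subgraph :: "'a ugraph \<Rightarrow> 'a set \<Rightarrow> 'a ugraph" where
  "induced_subgraph G W = (W, {e \<in> edges G. e \<subseteq> W})"

definition cycle_graph :: "'a list \<Rightarrow> 'a ugraph" where
  "cycle_graph c = (set c, {{c ! i, c ! (Suc i mod length c)} |i. i < length c})"

definition induced_cycle :: "'a ugraph \<Rightarrow> 'a list \<Rightarrow> bool" where
  "induced_cycle G c \<longleftrightarrow>
     length c \<ge> 3 \<and> distinct c \<and> set c \<subseteq> vertices G \<and>
     induced_subgraph G (set c) = cycle_graph c"

definition chordal :: "'a ugraph \<Rightarrow> bool" where
  "chordal G \<longleftrightarrow> \<not> (\<exists>c. induced_cycle G c \<and> length c > 3)"

definition clique :: "'a ugraph \<Rightarrow> 'a set \<Rightarrow> bool" where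
  "clique G K \<longleftrightarrow>
     K \<subseteq> vertices G \<and> (\<forall>u \<in> K. \<forall>v \<in> K. u \<noteq> v \<longrightarrow> {u, v} \<in> edges G)"

definition maximal_clique :: "'a ugraph \<Rightarrow> 'a set \<Rightarrow> bool" where
  "maximal_clique G K \<longleftrightarrow> clique G K \<and> (\<forall>K'. clique G K' \<and> K \<subseteq> K' \<longrightarrow> K' = K)"

definition mc :: "'a ugraph \<Rightarrow> nat" where
  "mc G = card {K. maximal_clique G K}"

definition clique_vertex_irreducible :: "'a ugraph \<Rightarrow> bool" where
  "clique_vertex_irreducible G \<longleftrightarrow>
     (\<forall>K. maximal_clique G K \<longrightarrow>
        (\<exists>v \<in> K. \<forall>K'. maximal_clique G K' \<and> K' \<noteq> K \<longrightarrow> v \<notin> K'))"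

definition biclique :: "'a set \<Rightarrow> 'a set \<Rightarrow> 'a ugraph" where
  "biclique L R = (L \<union> R, {{u, v} |u v. u \<in> L \<and> v \<in> R})"

definition is_biclique :: "'a ugraph \<Rightarrow> bool" where
  "is_biclique B \<longleftrightarrow> (\<exists>L R. L \<inter> R = {} \<and> B = biclique L R)"

definition biclique_partition :: "'a ugraph \<Rightarrow> 'a ugraph set \<Rightarrow> bool" where
  "biclique_partition G P \<longleftrightarrow>
     (\<forall>B \<in> P. is_biclique B \<and> subgraph B G) \<and>
     (\<forall>e \<in> edges G. \<exists>!B. B \<in> P \<and> e \<in> edges B)"

definition bp :: "'a ugraph \<Rightarrow> nat" where
  "bp G = (LEAST k. \<exists>P. biclique_partition G P \<and> finite P \<and> card P = k)"

end

theory Submission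
  imports Complex_Main Defs
begin

text \<open>Lower bound: vertices private to distinct maximal cliques of \<open>G\<^sup>c\<close> are nonadjacent there, so
  \<open>G\<close> contains a complete graph on \<open>mc(G\<^sup>c)\<close> vertices, and Graham--Pollak applies. Upper bound,
  for every chordal \<open>G\<^sup>c\<close>: delete a simplicial vertex \<open>v\<close> with closed neighbourhood \<open>K\<close> in \<open>G\<^sup>c\<close>.
  If \<open>K - v\<close> is not a maximal clique afterwards, one maximal clique is lost and the single biclique
  between \<open>v\<close> and the complement of \<open>K\<close> repairs the partition. Otherwise \<open>v\<close> has to be
  inserted into the existing bicliques, which is possible because the induction also provides
  such a placement for a hypothetical new vertex attached to any given maximal clique.\<close>

section \<open>The Graham--Pollak bound\<close>

text \<open>Gaussian elimination: an equation \<open>j\<close> with a nonzero coefficient at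
  \<open>v\<close> is solved for \<open>x v\<close>, which leaves the equations in \<open>I\<close>
  with the unknowns of \<open>X - {v}\<close>.\<close>

lemma homogeneous_system_nontrivial_solution:
  fixes a :: "'i \<Rightarrow> 'a \<Rightarrow> real"
  assumes "finite I" "finite X" "card I < card X"
  shows "\<exists>x. (\<exists>v\<in>X. x v \<noteq> 0) \<and> (\<forall>i\<in>I. (\<Sum>v\<in>X. a i v * x v) = 0)"
  using assms
proof (induction I arbitrary: X a rule: finite_induct)
  case empty
  then obtain v where "v \<in> X" by fastforce
  then show ?case by (intro exI[of _ "\<lambda>_. 1"]) auto
next
  case (insert j I)
  show ?case
  proof (cases "\<forall>v\<in>X. a j v = 0")
    case True
    have "card I < card X" using insert by simp
    from insert.IH[OF insert.prems(1) this, of a] True show ?thesis by auto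
  next
    case False
    then obtain v where v: "v \<in> X" "a j v \<noteq> 0" by blast
    define X' where "X' = X - {v}"
    have X': "finite X'" "card I < card X'" "X = insert v X'" "v \<notin> X'"
      using insert.prems insert.hyps v by (auto simp: X'_def)
    obtain x where x: "\<exists>u\<in>X'. x u \<noteq> 0"
      and eq: "\<And>i. i \<in> I \<Longrightarrow> (\<Sum>u\<in>X'. (a i u - a i v / a j v * a j u) * x u) = 0"
      using insert.IH[OF X'(1,2), of "\<lambda>i u. a i u - a i v / a j v * a j u"] by auto
    define s where "s = (\<Sum>u\<in>X'. a j u * x u)"
    \<comment> \<open>The value at \<open>v\<close> is the one that equation \<open>j\<close>
      forces.\<close>
    define y where "y = x(v := - s / a j v)"
    have sum_y: "(\<Sum>u\<in>X. a i u * y u) = (\<Sum>u\<in>X'. a i u * x u) - a i v / a j v * s" for i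
    proof -
      have "(\<Sum>u\<in>X'. a i u * y u) = (\<Sum>u\<in>X'. a i u * x u)"
        using X'(4) by (intro sum.cong) (auto simp: y_def)
      then show ?thesis using X' by (simp add: y_def)
    qed
    have "(\<Sum>u\<in>X. a i u * y u) = 0" if "i \<in> insert j I" for i
    proof (cases "i = j")
      case True
      then show ?thesis using v by (simp add: sum_y s_def)
    next
      case False
      then have "(\<Sum>u\<in>X'. a i u * x u) - (\<Sum>u\<in>X'. a i v / a j v * (a j u * x u)) = 0"
        using eq[of i] that by (simp add: left_diff_distrib sum_subtractf mult.assoc)
      then show ?thesis by (simp add: sum_y s_def sum_distrib_left)
    qed
    moreover have "\<exists>u\<in>X. y u \<noteq> 0" using x X' by (auto simp: y_def)
    ultimately show ?thesis by blast
  qed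
qed

lemma edges_biclique_iff:
  "{u, v} \<in> edges (biclique L R) \<longleftrightarrow> u \<in> L \<and> v \<in> R \<or> u \<in> R \<and> v \<in> L"
  by (auto simp: biclique_def doubleton_eq_iff)

text \<open>If there were fewer bicliques, some nonzero \<open>x\<close> on \<open>X\<close> would have sum zero over
  \<open>X\<close> and over the left side of every biclique, so that \<open>0 = (\<Sum> x)\<^sup>2 = \<Sum> x\<^sup>2\<close>.\<close>

theorem Graham_Pollak:
  assumes P: "biclique_partition G P" "finite P"
    and X: "clique G X" "finite X"
  shows "card X \<le> Suc (card P)"
proof (rule ccontr)
  assume "\<not> ?thesis"
  then have less: "Suc (card P) < card X" by simp
  have "\<forall>B\<in>P. \<exists>L R. L \<inter> R = {} \<and> B = biclique L R"
    using P by (auto simp: biclique_partition_def is_biclique_def)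
  then obtain L R where LR: "\<And>B. B \<in> P \<Longrightarrow> L B \<inter> R B = {} \<and> B = biclique (L B) (R B)"
    by metis
  \<comment> \<open>\<open>None\<close> stands for the sum over all of \<open>X\<close>,
    \<open>Some B\<close> for the sum over the left side of \<open>B\<close>; this makes
    \<open>Suc (card P)\<close> equations.\<close>
  define a :: "'a ugraph option \<Rightarrow> 'a \<Rightarrow> real"
    where "a i v = (case i of None \<Rightarrow> 1 | Some B \<Rightarrow> of_bool (v \<in> L B))" for i v
  have "card (insert None (Some ` P)) < card X"
    using less P(2) by (simp add: card_image)
  from homogeneous_system_nontrivial_solution[OF _ X(2) this, of a] P(2)
  obtain x where nz: "\<exists>v\<in>X. x v \<noteq> 0"
    and sol: "\<forall>i\<in>insert None (Some ` P). (\<Sum>v\<in>X. a i v * x v) = 0" by auto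
  from sol have sum0: "(\<Sum>v\<in>X. x v) = 0"
    and sumL: "\<And>B. B \<in> P \<Longrightarrow> (\<Sum>v\<in>X. of_bool (v \<in> L B) * x v) = 0"
    by (auto simp: a_def)
  define c :: "'a ugraph \<Rightarrow> 'a \<Rightarrow> 'a \<Rightarrow> real" where "c B u v = of_bool ({u, v} \<in> edges B)" for B u v
  \<comment> \<open>As the sides are disjoint, the sum over ordered pairs is twice the product of
    the sums of \<open>x\<close> over the two sides within \<open>X\<close>, and the left one
    vanishes.\<close>
  have c_zero: "(\<Sum>u\<in>X. \<Sum>v\<in>X. c B u v * (x u * x v)) = 0" if B: "B \<in> P" for B
  proof -
    let ?l = "\<lambda>u. of_bool (u \<in> L B) * x u" and ?r = "\<lambda>u. of_bool (u \<in> R B) * x u"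
    have "c B u v * (x u * x v) = ?l u * ?r v + ?r u * ?l v" for u v
      using LR[OF B] edges_biclique_iff[of u v "L B" "R B"] by (auto simp: c_def)
    then have "(\<Sum>u\<in>X. \<Sum>v\<in>X. c B u v * (x u * x v))
        = (\<Sum>u\<in>X. ?l u) * (\<Sum>v\<in>X. ?r v) + (\<Sum>u\<in>X. ?r u) * (\<Sum>v\<in>X. ?l v)"
      by (simp only: sum_product sum.distrib)
    then show ?thesis using sumL[OF B] by simp
  qed
  \<comment> \<open>Two distinct vertices of the clique span an edge, which is counted once;
    disjointness of the sides excludes loops.\<close>
  have c_sum: "(\<Sum>B\<in>P. c B u v) = of_bool (u \<noteq> v)" if uv: "u \<in> X" "v \<in> X" for u v
  proof (cases "u = v")
    case True
    have "c B u v = 0" if "B \<in> P" for B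
      using LR[OF that] edges_biclique_iff[of u v "L B" "R B"] True by (auto simp: c_def)
    then show ?thesis using True by simp
  next
    case False
    then have "{u, v} \<in> edges G" using X uv by (auto simp: clique_def)
    then obtain B where B: "B \<in> P" "{u, v} \<in> edges B"
      and uniq: "\<And>B'. B' \<in> P \<Longrightarrow> {u, v} \<in> edges B' \<Longrightarrow> B' = B"
      using P(1) unfolding biclique_partition_def by metis
    have "{u, v} \<in> edges B' \<longleftrightarrow> B' = B" if "B' \<in> P" for B'
      using B uniq that by blast
    then have "c B' u v = (if B' = B then 1 else 0)" if "B' \<in> P" for B'
      using that by (simp add: c_def)
    then have "(\<Sum>B'\<in>P. c B' u v) = (\<Sum>B'\<in>P. if B' = B then 1 else 0)"
      by (intro sum.cong) auto
    then show ?thesis using B P(2) False by simp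
  qed
  have "0 = (\<Sum>u\<in>X. \<Sum>v\<in>X. x u * x v)"
    by (simp add: sum0 flip: sum_product)
  also have "\<dots> = (\<Sum>u\<in>X. \<Sum>v\<in>X. (if u = v then x u * x v else 0) + (\<Sum>B\<in>P. c B u v) * (x u * x v))"
    by (intro sum.cong) (auto simp: c_sum)
  also have "\<dots> = (\<Sum>u\<in>X. \<Sum>v\<in>X. if u = v then x u * x v else 0)
      + (\<Sum>u\<in>X. \<Sum>v\<in>X. \<Sum>B\<in>P. c B u v * (x u * x v))"
    by (simp add: sum.distrib sum_distrib_right)
  also have "(\<Sum>u\<in>X. \<Sum>v\<in>X. \<Sum>B\<in>P. c B u v * (x u * x v))
      = (\<Sum>B\<in>P. \<Sum>u\<in>X. \<Sum>v\<in>X. c B u v * (x u * x v))"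
    by (subst sum.swap[of _ X P], intro sum.cong refl, rule sum.swap)
  also have "\<dots> = 0" using c_zero by simp
  also have "(\<Sum>u\<in>X. \<Sum>v\<in>X. if u = v then x u * x v else 0) = (\<Sum>u\<in>X. x u * x u)"
    using X(2) by simp
  finally have "(\<Sum>u\<in>X. x u * x u) = 0" by simp
  then show False using nz X(2) by (simp add: sum_nonneg_eq_0_iff)
qed

section \<open>Simplicial vertices of chordal graphs\<close>

text \<open>A path of minimal length has these properties: at a forward chord or a repeated vertex a
  stretch could be cut out.\<close>

lemma rtranclp_imp_shortest_path:
  assumes "Q\<^sup>*\<^sup>* a b"
  obtains p where "p \<noteq> []" "hd p = a" "last p = b" "successively Q p" "distinct p"
    "\<And>i j. i < j \<Longrightarrow> j < length p \<Longrightarrow> Q (p ! i) (p ! j) \<Longrightarrow> j = Suc i"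
proof -
  let ?path = "\<lambda>p. p \<noteq> [] \<and> hd p = a \<and> last p = b \<and> successively Q p"
  have "\<exists>p. ?path p"
    using assms
  proof (induction rule: rtranclp_induct)
    case base
    show ?case by (intro exI[of _ "[a]"]) simp
  next
    case (step y z)
    then obtain p where "p \<noteq> []" "hd p = a" "last p = y" "successively Q p" by blast
    then show ?case using step(2)
      by (intro exI[of _ "p @ [z]"]) (auto simp: successively_append_iff)
  qed
  then obtain p where p: "?path p" and min: "\<And>q. ?path q \<Longrightarrow> length p \<le> length q"
    using ex_has_least_nat[of ?path _ length] by blast
  have sub: "successively Q (take i p)" "successively Q (drop i p)" for i
    using p successively_append_iff[of Q "take i p" "drop i p"] by auto
  have chord: "j = Suc i" if "i < j" "j < length p" "Q (p ! i) (p ! j)" for i j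
  proof -
    let ?q = "take (Suc i) p @ drop j p"
    have "last (take (Suc i) p) = p ! i" using that by (simp add: take_Suc_conv_app_nth)
    moreover have "hd (drop j p) = p ! j" using that by (simp add: hd_drop_conv_nth)
    ultimately have "?path ?q"
      using that p sub by (auto simp: successively_append_iff)
    from min[OF this] that show ?thesis by simp
  qed
  have neq: "p ! i \<noteq> p ! j" if "i < j" "j < length p" for i j
  proof
    assume eq: "p ! i = p ! j"
    let ?q = "take (Suc i) p @ drop (Suc j) p"
    have la: "last (take (Suc i) p) = p ! j"
      using that eq by (simp add: take_Suc_conv_app_nth)
    have "?path ?q"
    \<comment> \<open>If \<open>j\<close> is the last position, nothing follows the cut and the new
      path already ends in \<open>p ! j = b\<close>.\<close>
    proof (cases "Suc j < length p")
      case True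
      then have "Q (p ! j) (hd (drop (Suc j) p))"
        using p by (simp add: hd_drop_conv_nth successively_conv_nth)
      then show ?thesis using True p sub la by (auto simp: successively_append_iff)
    next
      case False
      then have "length p = Suc j" using that by simp
      then have "last p = p ! j" using last_conv_nth[of p] p by simp
      then show ?thesis using False p sub la by auto
    qed
    from min[OF this] that show False by simp
  qed
  have "distinct p"
    unfolding distinct_conv_nth using neq by (metis linorder_neqE_nat)
  then show thesis using that p chord by blast
qed

section \<open>Chordless cycles and simplicial vertices in a chordal graph\<close>

locale chordal_graph =
  fixes H :: "'a ugraph"
  assumes simple: "finite_simple_graph H" and chordal: "chordal H"
begin

abbreviation adj :: "'a \<Rightarrow> 'a \<Rightarrow> bool" where
  "adj u v \<equiv> {u, v} \<in> edges H"

lemma adj_sym: "adj u v \<longleftrightarrow> adj v u"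
  by (simp add: insert_commute)

lemma no_loop [simp]: "{u} \<notin> edges H"
  using simple by (force simp: finite_simple_graph_def)

lemma adj_vertices: "adj u v \<Longrightarrow> u \<in> vertices H \<and> v \<in> vertices H"
  using simple by (auto simp: finite_simple_graph_def)

lemma edge_obtain:
  assumes "e \<in> edges H"
  obtains u v where "e = {u, v}" "adj u v"
  using assms simple by (auto simp: finite_simple_graph_def card_2_iff)

text \<open>Prepending \<open>x\<close> to \<open>p\<close> gives an induced cycle on at least four
  vertices, which chordality forbids.\<close>

lemma no_long_chordless_cycle:
  assumes p: "distinct p" "length p \<ge> 3" "x \<notin> set p"
    and path: "\<And>i j. i < j \<Longrightarrow> j < length p \<Longrightarrow> adj (p ! i) (p ! j) \<longleftrightarrow> j = Suc i"
    and x: "\<And>i. i < length p \<Longrightarrow> adj x (p ! i) \<longleftrightarrow> i = 0 \<or> Suc i = length p"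
  shows False
proof -
  define c where "c = x # p"
  let ?n = "length c"
  \<comment> \<open>Positions in \<open>c\<close> are those in \<open>p\<close> shifted by one, with
    \<open>x\<close> at \<open>0\<close>; the second alternative is the edge that closes the
    cycle.\<close>
  have adj_c: "adj (c ! i) (c ! j) \<longleftrightarrow> j = Suc i \<or> i = 0 \<and> Suc j = ?n" if "i < j" "j < ?n" for i j
    using that path[of "i - 1" "j - 1"] x[of "j - 1"]
    by (cases i; cases j) (auto simp: c_def)
  have cyc: "adj (c ! i) (c ! (Suc i mod ?n))" if "i < ?n" for i
  proof (cases "Suc i = ?n")
    case True
    moreover have "0 < i" using True p(2) by (cases i) (auto simp: c_def)
    ultimately have "adj (c ! 0) (c ! i)" using adj_c[of 0 i] that by simp
    then show ?thesis using True adj_sym by simp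
  next
    case False
    then show ?thesis using adj_c[of i "Suc i"] that by auto
  qed
  have verts: "set c \<subseteq> vertices H"
    using cyc adj_vertices by (metis in_set_conv_nth subsetI)
  have "e \<in> edges (cycle_graph c)" if e: "e \<in> edges H" "e \<subseteq> set c" for e
  proof -
    obtain u v where uv: "e = {u, v}" "adj u v" using edge_obtain e by metis
    then obtain i j where ij: "u = c ! i" "v = c ! j" "i < ?n" "j < ?n"
      using e by (metis in_set_conv_nth insert_subset)
    have "\<exists>i j. e = {c ! i, c ! j} \<and> i < j \<and> j < ?n \<and> adj (c ! i) (c ! j)"
    proof (cases i j rule: linorder_cases)
      case less
      then show ?thesis using ij uv by blast
    next
      case equal
      then show ?thesis using ij uv by simp
    next
      case greater
      moreover have "e = {c ! j, c ! i}" "adj (c ! j) (c ! i)"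
        using ij uv by (simp_all add: insert_commute)
      ultimately show ?thesis using ij by blast
    qed
    then obtain i j where ij: "e = {c ! i, c ! j}" "i < j" "j < ?n" "adj (c ! i) (c ! j)"
      by blast
    from adj_c[OF ij(2,3)] ij(4) consider "j = Suc i" | "i = 0" "Suc j = ?n" by blast
    then have "\<exists>k<?n. e = {c ! k, c ! (Suc k mod ?n)}"
    proof cases
      case 1
      then show ?thesis using ij by (intro exI[of _ i]) auto
    next
      case 2
      then show ?thesis using ij by (intro exI[of _ j]) (auto simp: insert_commute)
    qed
    then show ?thesis by (auto simp: cycle_graph_def)
  qed
  moreover have "e \<in> edges H \<and> e \<subseteq> set c" if e: "e \<in> edges (cycle_graph c)" for e
  proof -
    obtain i where i: "i < ?n" "e = {c ! i, c ! (Suc i mod ?n)}"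
      using e by (auto simp: cycle_graph_def)
    moreover have "Suc i mod ?n < ?n" using i(1) by (intro mod_less_divisor) linarith
    ultimately show ?thesis using cyc by simp
  qed
  ultimately have "edges (induced_subgraph H (set c)) = edges (cycle_graph c)"
    by (auto simp: induced_subgraph_def)
  then have "induced_subgraph H (set c) = cycle_graph c"
    by (simp add: induced_subgraph_def cycle_graph_def)
  then have "induced_cycle H c" "length c > 3"
    using verts p by (auto simp: induced_cycle_def c_def)
  then show False using chordal by (auto simp: chordal_def)
qed

text \<open>Relative to \<open>W\<close>, because the inductions shrink the vertex set while
  \<open>H\<close> and its chordality stay fixed.\<close>

definition simplicial_in :: "'a set \<Rightarrow> 'a \<Rightarrow> bool" where
  "simplicial_in W v \<longleftrightarrow> v \<in> W \<and> (\<forall>a\<in>W. \<forall>b\<in>W. adj v a \<longrightarrow> adj v b \<longrightarrow> a \<noteq> b \<longrightarrow> adj a b)"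

text \<open>Let \<open>C\<close> be a component of the graph minus the closed neighbourhood of \<open>x\<close>, and \<open>S\<close> its
  boundary. A shortest path through \<open>C\<close> between two nonadjacent vertices of \<open>S\<close> would close up
  with \<open>x\<close> to a long induced cycle, so \<open>S\<close> is a clique; apply induction to \<open>C \<union> S\<close>.\<close>

lemma simplicial_outside_neighbourhood:
  assumes "finite W" "x \<in> W" "y \<in> W" "y \<noteq> x" "\<not> adj x y"
  shows "\<exists>v. simplicial_in W v \<and> v \<noteq> x \<and> \<not> adj x v"
  using assms
proof (induction "card W" arbitrary: W x y rule: less_induct)
  case less
  define U where "U = {u \<in> W. u \<noteq> x \<and> \<not> adj x u}"
  define C where "C = {u. (\<lambda>u w. adj u w \<and> w \<in> U)\<^sup>*\<^sup>* y u}"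
  define S where "S = {s \<in> W - C. \<exists>c\<in>C. adj c s}"
  have yU: "y \<in> U" using less.prems by (simp add: U_def)
  have "u \<in> U" if "u \<in> C" for u
    using that[unfolded C_def mem_Collect_eq] yU by (induction rule: rtranclp_induct) auto
  then have CU: "C \<subseteq> U" by blast
  have yC: "y \<in> C" by (simp add: C_def)
  have C_closed: "w \<in> C" if "u \<in> C" "adj u w" "w \<in> U" for u w
    using that by (auto simp: C_def intro: rtranclp.rtrancl_into_rtrancl)
  \<comment> \<open>A boundary vertex in \<open>U\<close> would already belong to \<open>C\<close>,
    so it is a neighbour of \<open>x\<close>; it is not \<open>x\<close> itself, which has no
    neighbour in \<open>C\<close>.\<close>
  have S_adj: "adj x s \<and> s \<noteq> x" if s: "s \<in> S" for s
  proof -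
    obtain c where c: "c \<in> C" "adj c s" "s \<in> W" "s \<notin> C" using s by (auto simp: S_def)
    then have "s \<notin> U" using C_closed by blast
    moreover have "s \<noteq> x" using c CU by (auto simp: U_def adj_sym)
    ultimately show ?thesis using c by (auto simp: U_def)
  qed
  have S_clique: "adj a b" if ab: "a \<in> S" "b \<in> S" "a \<noteq> b" for a b
  proof (rule ccontr)
    assume nadj: "\<not> adj a b"
    let ?D = "insert a (insert b C)"
    \<comment> \<open>Paths are confined to \<open>C\<close> together with \<open>a\<close> and
      \<open>b\<close>, so only their ends can be adjacent to \<open>x\<close>.\<close>
    define Q where "Q u w \<longleftrightarrow> adj u w \<and> u \<in> ?D \<and> w \<in> ?D" for u w
    have symQ: "symp Q" by (auto simp: Q_def symp_def adj_sym)
    have Qy: "Q\<^sup>*\<^sup>* y u" if "u \<in> C" for u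
      using that[unfolded C_def mem_Collect_eq]
    proof (induction rule: rtranclp_induct)
      case base
      show ?case by simp
    next
      case (step u w)
      then have "u \<in> C" "w \<in> C" using C_closed by (auto simp: C_def)
      then have "Q u w" using step by (auto simp: Q_def)
      then show ?case using step by simp
    qed
    have reach: "Q\<^sup>*\<^sup>* y s" if s: "s \<in> {a, b}" for s
    proof -
      obtain c where "c \<in> C" "adj c s" using s ab by (auto simp: S_def)
      then have "Q c s" using that by (auto simp: Q_def)
      then show ?thesis using Qy[OF \<open>c \<in> C\<close>] by simp
    qed
    have "Q\<^sup>*\<^sup>* a y" using reach[of a] sympD[OF symp_rtranclp[OF symQ]] by blast
    then have "Q\<^sup>*\<^sup>* a b" using reach[of b] by simp
    then obtain p where p: "p \<noteq> []" "hd p = a" "last p = b" "successively Q p" "distinct p"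
      and chord: "\<And>i j. i < j \<Longrightarrow> j < length p \<Longrightarrow> Q (p ! i) (p ! j) \<Longrightarrow> j = Suc i"
      using rtranclp_imp_shortest_path by metis
    have Qi: "Q (p ! i) (p ! Suc i)" if "Suc i < length p" for i
      using p(4) that by (simp add: successively_conv_nth)
    have p0: "p ! 0 = a" and pl: "p ! (length p - 1) = b"
      using p by (auto simp: hd_conv_nth last_conv_nth)
    have inD: "p ! i \<in> ?D" if "i < length p" for i
      using that Qi[of "i - 1"] p0 by (cases i) (auto simp: Q_def)
    have len: "length p \<ge> 3"
    proof (rule ccontr)
      assume "\<not> ?thesis"
      then have "length p = 1 \<or> length p = 2" using p(1) by (cases "length p") auto
      then show False using p0 pl Qi[of 0] ab(3) nadj by (auto simp: Q_def numeral_2_eq_2)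
    qed
    show False
    proof (rule no_long_chordless_cycle[OF p(5) len])
      show "x \<notin> set p"
        using inD S_adj ab CU by (auto simp: in_set_conv_nth U_def)
      show "adj (p ! i) (p ! j) \<longleftrightarrow> j = Suc i" if "i < j" "j < length p" for i j
        using that Qi[of i] chord[of i j] inD[of i] inD[of j] by (auto simp: Q_def)
      show "adj x (p ! i) \<longleftrightarrow> i = 0 \<or> Suc i = length p" if "i < length p" for i
      proof
        assume "adj x (p ! i)"
        then have "p ! i = a \<or> p ! i = b" using inD[OF that] CU by (auto simp: U_def)
        then have "i = 0 \<or> i = length p - 1"
          using p0 pl that p(1,5) by (metis diff_less length_greater_0_conv nth_eq_iff_index_eq zero_less_one)
        then show "i = 0 \<or> Suc i = length p" using that by auto
      next
        assume "i = 0 \<or> Suc i = length p"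
        then have "i = 0 \<or> i = length p - 1" by auto
        then show "adj x (p ! i)" using S_adj ab p0 pl by metis
      qed
    qed
  qed
  define W' where "W' = C \<union> S"
  have W'W: "W' \<subseteq> W" using CU by (auto simp: W'_def S_def U_def)
  have xW': "x \<notin> W'" using CU S_adj by (auto simp: W'_def U_def)
  have W': "finite W'" "card W' < card W"
    using W'W xW' less.prems by (auto intro: finite_subset psubset_card_mono)
  \<comment> \<open>All neighbours in \<open>W\<close> of a vertex of \<open>C\<close> lie in
    \<open>C\<close> or \<open>S\<close>, so being simplicial in \<open>W'\<close> carries over to
    \<open>W\<close>.\<close>
  have lift: "simplicial_in W v \<and> v \<noteq> x \<and> \<not> adj x v" if v: "simplicial_in W' v" "v \<in> C" for v
  proof -
    have "w \<in> W'" if "w \<in> W" "adj v w" for w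
      using that v by (auto simp: W'_def S_def)
    then have "simplicial_in W v" using v W'W by (auto simp: simplicial_in_def)
    then show ?thesis using v CU by (auto simp: U_def)
  qed
  show ?case
  proof (cases "\<forall>a\<in>W'. \<forall>b\<in>W'. a \<noteq> b \<longrightarrow> adj a b")
    case True
    then have "simplicial_in W' y" using yC by (auto simp: simplicial_in_def W'_def)
    then show ?thesis using lift yC by blast
  next
    case False
    \<comment> \<open>With \<open>a\<close> equal or adjacent to everything in \<open>S\<close>, the
      induction hypothesis at \<open>a\<close> yields a simplicial vertex outside \<open>S\<close>,
      hence in \<open>C\<close>. If some vertex of \<open>S\<close> has a non-neighbour in
      \<open>W'\<close>, it serves as \<open>a\<close>; otherwise \<open>S\<close> is joined to all
      of \<open>W'\<close> and any nonadjacent pair will do.\<close>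
    have "\<exists>a\<in>W'. \<exists>b\<in>W'. a \<noteq> b \<and> \<not> adj a b \<and> (\<forall>s\<in>S. s = a \<or> adj a s)"
    proof (cases "\<exists>a\<in>S. \<exists>b\<in>W'. a \<noteq> b \<and> \<not> adj a b")
      case True
      then show ?thesis using S_clique by (fastforce simp: W'_def)
    next
      case noS: False
      from False obtain a b where ab: "a \<in> W'" "b \<in> W'" "a \<noteq> b" "\<not> adj a b" by blast
      then have "a \<notin> S" using noS by blast
      then have "adj s a" if "s \<in> S" for s using noS ab(1) that by metis
      then have "adj a s" if "s \<in> S" for s using that adj_sym by metis
      then show ?thesis using ab by blast
    qed
    then obtain a b where ab: "a \<in> W'" "b \<in> W'" "a \<noteq> b" "\<not> adj a b"
      and aS: "\<And>s. s \<in> S \<Longrightarrow> s = a \<or> adj a s" by blast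
    from less.hyps[OF W'(2,1) ab(1,2) _ ab(4)] ab(3)
    obtain v where v: "simplicial_in W' v" "v \<noteq> a" "\<not> adj a v" by blast
    then have "v \<in> C" using aS by (auto simp: simplicial_in_def W'_def)
    then show ?thesis using lift v by blast
  qed
qed

theorem simplicial_vertex_exists:
  assumes "finite W" "W \<noteq> {}"
  shows "\<exists>v. simplicial_in W v"
proof (cases "\<forall>a\<in>W. \<forall>b\<in>W. a \<noteq> b \<longrightarrow> adj a b")
  case True
  then show ?thesis using assms by (auto simp: simplicial_in_def)
next
  case False
  then show ?thesis using simplicial_outside_neighbourhood[OF assms(1)] by metis
qed

section \<open>Maximal cliques after deletion of a simplicial vertex\<close>

abbreviation max_cliques :: "'a set \<Rightarrow> 'a set set" where
  "max_cliques W \<equiv> {K. maximal_clique (induced_subgraph H W) K}"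

lemma clique_induced_iff:
  "clique (induced_subgraph H W) K \<longleftrightarrow> K \<subseteq> W \<and> (\<forall>u\<in>K. \<forall>v\<in>K. u \<noteq> v \<longrightarrow> adj u v)"
  by (auto simp: clique_def induced_subgraph_def)

lemma finite_max_cliques: "finite W \<Longrightarrow> finite (max_cliques W)"
  by (rule finite_subset[of _ "Pow W"]) (auto simp: maximal_clique_def clique_induced_iff)

text \<open>Every clique through \<open>v\<close> lies in \<open>K\<close>, itself a clique. So
  \<open>K\<close> is the only maximal clique containing \<open>v\<close>, and only
  \<open>K - {v}\<close> can lose its maximality when \<open>v\<close> is added.\<close>

lemma max_cliques_remove_simplicial:
  assumes v: "simplicial_in W v" and K: "K = insert v {w \<in> W. adj v w}"
  shows "max_cliques W = insert K (max_cliques (W - {v}) - {K - {v}})"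
proof -
  let ?cl = "\<lambda>W. clique (induced_subgraph H W)"
  have K_clique: "?cl W K"
    using v by (auto simp: K simplicial_in_def clique_induced_iff adj_sym)
  have in_K: "A \<subseteq> K" if "?cl W A" "v \<in> A" for A
    using that by (fastforce simp: K clique_induced_iff)
  have cl_minus: "?cl (W - {v}) A \<longleftrightarrow> ?cl W A \<and> v \<notin> A" for A
    by (auto simp: clique_induced_iff)
  have K_max: "K \<in> max_cliques W"
    using K_clique in_K by (fastforce simp: maximal_clique_def K)
  have K': "?cl (W - {v}) (K - {v})"
    using K_clique by (auto simp: clique_induced_iff)
  have only_K: "A = K" if "A \<in> max_cliques W" "v \<in> A" for A
  proof -
    have "?cl W A" "\<forall>B. ?cl W B \<and> A \<subseteq> B \<longrightarrow> B = A"
      using that by (simp_all add: maximal_clique_def)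
    then show ?thesis using in_K[of A] that K_clique by blast
  qed
  have down: "A \<in> max_cliques (W - {v}) \<and> A \<noteq> K - {v}" if A: "A \<in> max_cliques W" "A \<noteq> K" for A
  proof -
    have "v \<notin> A" using only_K A by blast
    moreover have "A \<noteq> K - {v}" using A K_clique by (auto simp: maximal_clique_def)
    ultimately show ?thesis using A by (auto simp: maximal_clique_def cl_minus)
  qed
  have up: "A \<in> max_cliques W" if A: "A \<in> max_cliques (W - {v})" "A \<noteq> K - {v}" for A
  proof -
    have cl: "?cl W A" "v \<notin> A" using A by (auto simp: maximal_clique_def cl_minus)
    have "B = A" if B: "?cl W B" "A \<subseteq> B" for B
    proof (cases "v \<in> B")
      case True
      then have "A \<subseteq> K - {v}" using in_K B cl by blast
      then show ?thesis using A K' by (auto simp: maximal_clique_def)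
    next
      case False
      then show ?thesis using A B by (auto simp: maximal_clique_def cl_minus)
    qed
    then show ?thesis using cl by (auto simp: maximal_clique_def)
  qed
  show ?thesis using K_max down up by blast
qed

end

section \<open>Biclique partitions from sign vectors\<close>

text \<open>If the sign of coordinate \<open>i\<close> records the side taken in the
  \<open>i\<close>-th biclique, this counts the bicliques that contain the edge between two
  vertices.\<close>

definition opposed :: "nat \<Rightarrow> (nat \<Rightarrow> int) \<Rightarrow> (nat \<Rightarrow> int) \<Rightarrow> nat" where
  "opposed n p q = card {i. i < n \<and> p i * q i < 0}"

lemma opposed_Suc: "opposed (Suc n) p q = opposed n p q + of_bool (p n * q n < 0)"
proof -
  have "{i. i < Suc n \<and> p i * q i < 0} =
      {i. i < n \<and> p i * q i < 0} \<union> (if p n * q n < 0 then {n} else {})"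
    by (auto simp: less_Suc_eq)
  then show ?thesis by (auto simp: opposed_def)
qed

lemma opposed_self [simp]: "opposed n p p = 0"
  by (simp add: opposed_def mult_less_0_iff)

lemma opposed_commute: "opposed n p q = opposed n q p"
  by (simp add: opposed_def mult.commute)

lemma opposed_upd [simp]:
  "opposed n (p(n := a)) q = opposed n p q" "opposed n q (p(n := a)) = opposed n q p"
  unfolding opposed_def by (rule arg_cong[where f = card]; auto)+

lemma opposed_zero [simp]: "opposed n (\<lambda>_. 0) q = 0" "opposed n q (\<lambda>_. 0) = 0"
  by (simp_all add: opposed_def)

context chordal_graph
begin

text \<open>Coordinate \<open>i\<close> of the sign vectors encodes the \<open>i\<close>-th biclique: a vertex is on its left
  side, on its right side or outside of it according to the sign. The vector of a maximal clique
  is the one that a new vertex adjacent (in \<open>H\<close>) to precisely this clique would receive; carrying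
  these along makes the induction on the vertices work.\<close>

definition sign_vectors ::
    "nat \<Rightarrow> 'a set \<Rightarrow> ('a \<Rightarrow> nat \<Rightarrow> int) \<Rightarrow> ('a set \<Rightarrow> nat \<Rightarrow> int) \<Rightarrow> bool" where
  "sign_vectors n W f g \<longleftrightarrow>
     (\<forall>u\<in>W. \<forall>w\<in>W. opposed n (f u) (f w) = of_bool (u \<noteq> w \<and> \<not> adj u w)) \<and>
     (\<forall>u\<in>W. \<forall>A\<in>max_cliques W. opposed n (f u) (g A) = of_bool (u \<notin> A)) \<and>
     (\<forall>A\<in>max_cliques W. \<forall>B\<in>max_cliques W. opposed n (g A) (g B) = of_bool (A \<noteq> B))"

lemma sign_vectors_exist:
  assumes "finite W"
  shows "\<exists>n f g. Suc n = card (max_cliques W) \<and> sign_vectors n W f g"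
  using assms
proof (induction "card W" arbitrary: W)
  case 0
  \<comment> \<open>The empty set is one maximal clique and zero coordinates suffice: the source of
    the difference of one.\<close>
  then have "max_cliques W = {{}}" by (auto simp: maximal_clique_def clique_induced_iff)
  with 0 show ?case
    by (intro exI[of _ 0] exI[of _ "\<lambda>_ _. 0"]) (auto simp: sign_vectors_def)
next
  case (Suc k)
  then have "W \<noteq> {}" by auto
  then obtain v where v: "simplicial_in W v" using simplicial_vertex_exists Suc by blast
  then have vW: "v \<in> W" by (simp add: simplicial_in_def)
  define K where "K = insert v {w \<in> W. adj v w}"
  define W' where "W' = W - {v}"
  have W: "W = insert v W'" "v \<notin> W'" using vW by (auto simp: W'_def)
  have M: "max_cliques W = insert K (max_cliques W' - {K - {v}})"
    using max_cliques_remove_simplicial[OF v K_def] by (simp add: W'_def)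
  have v_notin: "v \<notin> A" if "A \<in> max_cliques W'" for A
    using that W by (auto simp: maximal_clique_def clique_induced_iff)
  have KM: "v \<in> K" "K \<notin> max_cliques W'" using v_notin K_def by auto
  have adj_v: "adj v u \<longleftrightarrow> u \<in> K" "adj u v \<longleftrightarrow> u \<in> K" if "u \<in> W'" for u
    using that W by (auto simp: K_def adj_sym)
  have "k = card W'" "finite W'" using Suc vW by (auto simp: W'_def)
  from Suc.hyps(1)[OF this] obtain n f g
    where n: "Suc n = card (max_cliques W')" and fg: "sign_vectors n W' f g" by blast
  note ff = fg[unfolded sign_vectors_def, THEN conjunct1, rule_format]
  note fgg = fg[unfolded sign_vectors_def, THEN conjunct2, THEN conjunct1, rule_format]
  note gg = fg[unfolded sign_vectors_def, THEN conjunct2, THEN conjunct2, rule_format]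
  have fin: "finite (max_cliques W')" using finite_max_cliques \<open>finite W'\<close> by blast
  show ?case
  proof (cases "K - {v} \<in> max_cliques W'")
    case True
    \<comment> \<open>\<open>K\<close> replaces \<open>K - {v}\<close>, so no coordinate may be
      added. Within \<open>W'\<close>, \<open>v\<close> is adjacent to exactly
      \<open>K - {v}\<close>, so \<open>v\<close> and \<open>K\<close> both take over the vector
      reserved for that clique; the condition on pairs of cliques then settles \<open>v\<close>
      against the others.\<close>
    define f' where "f' = f(v := g (K - {v}))"
    define g' where "g' = g(K := g (K - {v}))"
    have f': "f' v = g (K - {v})" "\<And>u. u \<in> W' \<Longrightarrow> f' u = f u"
      using W by (auto simp: f'_def)
    have g': "g' K = g (K - {v})" "\<And>A. A \<in> max_cliques W' \<Longrightarrow> g' A = g A"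
      using KM by (auto simp: g'_def)
    have "card (max_cliques W) = Suc n"
      using n True fin KM card_gt_0_iff[of "max_cliques W'"] by (auto simp: M)
    moreover have "sign_vectors n W f' g'"
      unfolding sign_vectors_def
    proof (intro conjI ballI)
      fix u w assume "u \<in> W" "w \<in> W"
      then show "opposed n (f' u) (f' w) = of_bool (u \<noteq> w \<and> \<not> adj u w)"
        using ff fgg[OF _ True] W adj_v
        by (auto simp: f' opposed_commute[of n "g _" "f _"])
    next
      fix u A assume "u \<in> W" "A \<in> max_cliques W"
      then show "opposed n (f' u) (g' A) = of_bool (u \<notin> A)"
        unfolding M
        using fgg True gg KM v_notin W by (auto simp: f' g')
    next
      fix A B assume "A \<in> max_cliques W" "B \<in> max_cliques W"
      then show "opposed n (g' A) (g' B) = of_bool (A \<noteq> B)"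
        unfolding M using gg True by (cases "A = K"; cases "B = K") (simp_all add: g' eq_commute[of "K - {v}"])
    qed
    ultimately show ?thesis by metis
  next
    case False
    \<comment> \<open>The new coordinate is the biclique between \<open>v\<close> and the vertices
      outside \<open>K\<close>. Old cliques miss \<open>v\<close>, so they join the negative side;
      the rest of \<open>K\<close> gets \<open>0\<close>; \<open>K\<close> shares the vector of
      \<open>v\<close>.\<close>
    define e :: "nat \<Rightarrow> int" where "e = (\<lambda>_. 0)(n := 1)"
    define f' where "f' u = (if u = v then e else (f u)(n := if u \<in> K then 0 else -1))" for u
    define g' where "g' A = (if A = K then e else (g A)(n := -1))" for A
    have f': "f' v = e" "\<And>u. u \<in> W' \<Longrightarrow> f' u = (f u)(n := if u \<in> K then 0 else -1)"
      using W by (auto simp: f'_def)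
    have g': "g' K = e" "\<And>A. A \<in> max_cliques W' \<Longrightarrow> g' A = (g A)(n := -1)"
      using KM by (auto simp: g'_def)
    have M': "max_cliques W = insert K (max_cliques W')" using M False by simp
    have "card (max_cliques W) = Suc (Suc n)"
      using n fin KM by (simp add: M')
    moreover have "sign_vectors (Suc n) W f' g'"
      unfolding sign_vectors_def
    proof (intro conjI ballI)
      fix u w assume "u \<in> W" "w \<in> W"
      then show "opposed (Suc n) (f' u) (f' w) = of_bool (u \<noteq> w \<and> \<not> adj u w)"
        using ff W adj_v by (auto simp: f' opposed_Suc e_def split: if_splits)
    next
      fix u A assume "u \<in> W" "A \<in> max_cliques W"
      then show "opposed (Suc n) (f' u) (g' A) = of_bool (u \<notin> A)"
        unfolding M'
        using fgg KM v_notin W by (auto simp: f' g' opposed_Suc e_def split: if_splits)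
    next
      fix A B assume "A \<in> max_cliques W" "B \<in> max_cliques W"
      then show "opposed (Suc n) (g' A) (g' B) = of_bool (A \<noteq> B)"
        unfolding M' using gg KM 
          by (cases "A = K"; cases "B = K") (simp_all add: g' opposed_Suc e_def)
    qed
    ultimately show ?thesis by metis
  qed
qed

end

section \<open>From sign vectors to a biclique partition\<close>

lemma finite_simple_graph_complement:
  "finite_simple_graph G \<Longrightarrow> finite_simple_graph (complement G)"
  by (auto simp: finite_simple_graph_def complement_def)

lemma edges_complement_iff:
  "{u, v} \<in> edges (complement G) \<longleftrightarrow>
     u \<in> vertices G \<and> v \<in> vertices G \<and> u \<noteq> v \<and> {u, v} \<notin> edges G"
  by (auto simp: complement_def doubleton_eq_iff insert_commute)

text \<open>Each coordinate becomes the biclique between its positive and its negative vertices. Two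
  vertices are opposed once if they span an edge of \<open>G\<close> and never otherwise, which is
  the partition property.\<close>

theorem chordal_complement_biclique_partition:
  assumes G: "finite_simple_graph G" and "chordal (complement G)"
  shows "\<exists>P. biclique_partition G P \<and> finite P \<and> card P < mc (complement G)"
proof -
  interpret chordal_graph "complement G"
    using assms by unfold_locales (auto intro: finite_simple_graph_complement)
  let ?V = "vertices G"
  have "induced_subgraph (complement G) ?V = complement G"
    by (auto simp: induced_subgraph_def complement_def)
  then have mc: "mc (complement G) = card (max_cliques ?V)" by (simp add: mc_def)
  have "finite ?V" using G by (simp add: finite_simple_graph_def)
  then obtain n f g where n: "Suc n = mc (complement G)" and "sign_vectors n ?V f g"
    using sign_vectors_exist mc by metis
  then have ff: "opposed n (f u) (f w) = of_bool (u \<noteq> w \<and> {u, w} \<in> edges G)"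
    if "u \<in> ?V" "w \<in> ?V" for u w
    using that by (auto simp: sign_vectors_def edges_complement_iff)
  define B where "B i = biclique {u \<in> ?V. f u i > 0} {u \<in> ?V. f u i < 0}" for i
  have B_iff: "{u, w} \<in> edges (B i) \<longleftrightarrow> u \<in> ?V \<and> w \<in> ?V \<and> f u i * f w i < 0" for u w i
    by (auto simp: B_def edges_biclique_iff mult_less_0_iff)
  have B_edge: "\<exists>u w. e = {u, w}" if "e \<in> edges (B i)" for e i
    using that by (auto simp: B_def biclique_def)
  have "edges (B i) \<subseteq> edges G" if "i < n" for i
  proof
    fix e assume e: "e \<in> edges (B i)"
    then obtain u w where uw: "e = {u, w}" using B_edge by blast
    then have "u \<in> ?V" "w \<in> ?V" "i \<in> {i. i < n \<and> f u i * f w i < 0}"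
      using e B_iff that by auto
    then have "opposed n (f u) (f w) \<noteq> 0" unfolding opposed_def
      by (metis (no_types, lifting) card_0_eq empty_iff finite_nat_set_iff_bounded mem_Collect_eq)
    then show "e \<in> edges G" using ff \<open>u \<in> ?V\<close> \<open>w \<in> ?V\<close> uw by (auto split: if_splits)
  qed
  moreover have "\<exists>!A. A \<in> B ` {..<n} \<and> e \<in> edges A" if e: "e \<in> edges G" for e
  proof -
    obtain u w where uw: "e = {u, w}" "u \<noteq> w" "u \<in> ?V" "w \<in> ?V"
      using G e by (auto simp: finite_simple_graph_def card_2_iff)
    then have "card {i. i < n \<and> f u i * f w i < 0} = 1"
      using ff[of u w] e by (simp add: opposed_def)
    then obtain i where i: "{i. i < n \<and> f u i * f w i < 0} = {i}" by (auto simp: card_1_singleton_iff)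
    have "j < n \<and> f u j * f w j < 0 \<longleftrightarrow> j = i" for j
      using i by blast
    then have B_i: "j < n \<and> e \<in> edges (B j) \<longleftrightarrow> j = i" for j
      using uw by (simp add: B_iff)
    show ?thesis
    proof (rule ex1I)
      show "B i \<in> B ` {..<n} \<and> e \<in> edges (B i)" using B_i[of i] by simp
      show "A = B i" if "A \<in> B ` {..<n} \<and> e \<in> edges A" for A
        using that B_i by (metis imageE lessThan_iff)
    qed
  qed
  moreover have "is_biclique (B i)" for i
    unfolding is_biclique_def B_def by (rule exI, rule exI, rule conjI[OF _ refl]) auto
  moreover have "vertices (B i) \<subseteq> ?V" for i
    by (auto simp: B_def biclique_def)
  ultimately have "biclique_partition G (B ` {..<n})"
    by (auto simp: biclique_partition_def subgraph_def)
  \<comment> \<open>Distinct coordinates may give the same edgeless biclique, so \<open>n\<close>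
    only bounds the size of the image.\<close>
  moreover have "card (B ` {..<n}) < mc (complement G)"
    using card_image_le[of "{..<n}" B] n by simp
  ultimately show ?thesis by blast
qed

section \<open>A clique of private vertices\<close>

lemma clique_extends_to_maximal_clique:
  assumes "finite (vertices G)" "clique G K"
  obtains M where "maximal_clique G M" "K \<subseteq> M"
proof -
  have "{A. clique G A} \<subseteq> Pow (vertices G)" by (auto simp: clique_def)
  then have "finite {A. clique G A}" using assms(1) finite_subset by blast
  from finite_has_maximal2[OF this, of K] assms(2)
  obtain M where "clique G M" "K \<subseteq> M" "\<forall>A. clique G A \<longrightarrow> M \<subseteq> A \<longrightarrow> M = A" by auto
  then show thesis by (intro that[of M]) (auto simp: maximal_clique_def)
qed

text \<open>Private vertices \<open>r K\<close> and \<open>r K'\<close> nonadjacent in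
  \<open>G\<close> would lie in a common maximal clique of the complement, which by privacy equals
  both \<open>K\<close> and \<open>K'\<close>.\<close>

lemma irreducible_complement_clique:
  assumes G: "finite_simple_graph G" and irr: "clique_vertex_irreducible (complement G)"
  shows "\<exists>X. clique G X \<and> finite X \<and> card X = mc (complement G)"
proof -
  let ?M = "{K. maximal_clique (complement G) K}"
  have fin: "finite (vertices G)" and V: "vertices (complement G) = vertices G"
    using G by (auto simp: finite_simple_graph_def complement_def)
  obtain r where r: "\<And>K. K \<in> ?M \<Longrightarrow> r K \<in> K"
    and priv: "\<And>K K'. K \<in> ?M \<Longrightarrow> K' \<in> ?M \<Longrightarrow> r K \<in> K' \<Longrightarrow> K' = K"
    using irr unfolding clique_vertex_irreducible_def mem_Collect_eq by metis
  have sub: "K \<subseteq> vertices G" if "K \<in> ?M" for K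
    using that V by (auto simp: maximal_clique_def clique_def)
  have inj: "inj_on r ?M" using r priv by (metis inj_onI)
  have "{r K, r K'} \<in> edges G" if K: "K \<in> ?M" "K' \<in> ?M" and ne: "r K \<noteq> r K'" for K K'
  proof (rule ccontr)
    assume "{r K, r K'} \<notin> edges G"
    then have "clique (complement G) {r K, r K'}"
      using ne r[OF K(1)] r[OF K(2)] sub K
      by (auto simp: clique_def V edges_complement_iff insert_commute)
    then obtain A where "maximal_clique (complement G) A" "{r K, r K'} \<subseteq> A"
      using clique_extends_to_maximal_clique fin V by metis
    then have "A = K" "A = K'" using priv K by auto
    then show False using ne by simp
  qed
  then have "clique G (r ` ?M)" using r sub by (auto simp: clique_def) blast
  moreover have "finite (r ` ?M)"
    using r sub by (intro finite_subset[OF _ fin]) blast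
  ultimately show ?thesis using inj by (metis card_image mc_def)
qed

theorem theorem6:
  fixes G :: "'a ugraph"
  assumes "finite_simple_graph G"
    and "vertices G \<noteq> {}"
    and "chordal (complement G)"
    and "clique_vertex_irreducible (complement G)"
  shows "int (bp G) = int (mc (complement G)) - 1"
proof -
  let ?size = "\<lambda>k. \<exists>P. biclique_partition G P \<and> finite P \<and> card P = k"
  obtain P where P: "biclique_partition G P" "finite P" "card P < mc (complement G)"
    using chordal_complement_biclique_partition assms by blast
  \<comment> \<open>The existence of \<open>P\<close> ensures that the \<open>LEAST\<close> in
    \<open>bp\<close> is attained.\<close>
  then have "?size (bp G)" unfolding bp_def by (intro LeastI[of ?size "card P"]) blast
  then obtain P' where P': "biclique_partition G P'" "finite P'" "card P' = bp G" by blast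
  obtain X where "clique G X" "finite X" "card X = mc (complement G)"
    using irreducible_complement_clique assms by blast
  then have "mc (complement G) \<le> Suc (bp G)" using Graham_Pollak P' by metis
  moreover have "bp G \<le> card P" unfolding bp_def using P by (intro Least_le) blast
  ultimately show ?thesis using P(3) by linarith
qed

end
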